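(* Let $\Omega$ be a finite set and $\{\mathcal L_i\}_{i\in\Omega}$ a finite family of connected simple closure spaces, $\mathcal L_i$ on $\Sigma_i$, and put $\mathbf\Sigma=\prod_i\Sigma_i$. Let $\mathcal L\in\mathsf S(\mathcal L_i,i\in\Omega)$ and let $u\in\mathbf{Cl}(\mathcal L,\mathcal L)$ be large and send atoms to atoms. Then there is a bijection $f$ of $\Omega$ and, for each $i\in\Omega$, an arrow $v_i\in\mathbf{Cl}(\mathcal L_i,\mathcal L_{f(i)})$ sending atoms to atoms, such that $u(p)_{f(i)}=v_i(p_i)$ for all $p\in\mathbf\Sigma$ and $i\in\Omega$.
   Context: A simple closure space on a nonempty set $\Sigma$ is a set $\mathcal L\subseteq 2^\Sigma$, ordered by inclusion, closed under arbitrary intersections and containing $\Sigma$, $\emptyset$ and all singletons; it is a complete atomistic lattice with top $1=\Sigma$ whose atoms are the singletons, and $p\in\Sigma$ is identified with $\{p\}$. $\mathbf{Cl}$ is the category of simple closure spaces with maps preserving arbitrary joins (hence $0$). $2$ is the simple closure space isomorphic to the two-element lattice. A map sending atoms to atoms induces a map on the underlying sets, denoted by the same letter. For $\mathbf\Sigma=\prod_\alpha\Sigma_\alpha$: $\pi_\beta$ is the $\beta$-th coordinate map; $p[B,\beta]$ (for $p\in\mathbf\Sigma$, $B\subseteq\Sigma_\beta$) is the set of points obtained from $p$ by replacing its $\beta$-th entry by an element of $B$. $\mathsf S(\mathcal L_\alpha,\alpha\in\Omega)$ is the set of all simple closure spaces $\mathcal L$ on $\mathbf\Sigma=\prod_\alpha\Sigma_\alpha$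 such that (P2) $\bigcup_\alpha\pi_\alpha^{-1}(a_\alpha)\in\mathcal L$ for all $a\in\prod_\alpha\mathcal L_\alpha$; and (P3) for all $p\in\mathbf\Sigma$, $\beta\in\Omega$, $B\subseteq\Sigma_\beta$, $p[B,\beta]\in\mathcal L$ implies $B\in\mathcal L_\beta$. A simple closure space $\mathcal L$ on $\Sigma$ is connected if $\mathcal L\neq2$ and for all $p\ne q$ in $\Sigma$, $p\vee q$ contains a third atom $r$ such that $p\in q\vee r$ and $q\in p\vee r$. For $\mathcal L_\alpha\ne2$ and $\mathcal L\in\mathsf S(\mathcal L_\alpha,\alpha\in\Omega)$, a map $u\in\mathbf{Cl}(\mathcal L,\mathcal L)$ is large if for all $\beta\in\Omega$ and $p\in\mathbf\Sigma$: $u(p[\Sigma_\beta,\beta])$ is not an atom of $\mathcal L$, and $u(1)\not\subseteq\pi_\beta^{-1}(p_\beta)$. *)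

theory Defs
  imports Main "HOL.Hull" "HOL-Library.FuncSet"
begin

definition simple_closure_space :: "'a set \<Rightarrow> 'a set set \<Rightarrow> bool" where
  "simple_closure_space X L \<longleftrightarrow>
     X \<noteq> {} \<and> L \<subseteq> Pow X \<and> X \<in> L \<and> {} \<in> L \<and> (\<forall>p\<in>X. {p} \<in> L) \<and>
     (\<forall>A. A \<subseteq> L \<and> A \<noteq> {} \<longrightarrow> \<Inter>A \<in> L)"

text \<open>The join in \<open>L\<close>: the least member of \<open>L\<close> containing the union
  (see \<open>cl_join_least\<close> below).\<close>

definition cl_join :: "'a set set \<Rightarrow> 'a set set \<Rightarrow> 'a set" where
  "cl_join L S = (\<lambda>A. A \<in> L) hull \<Union>S"

text \<open>Only the values on \<open>L\<close> of an arrow \<open>L \<rightarrow> M\<close> matter; elsewhere it is arbitrary.\<close>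

definition Cl :: "'a set set \<Rightarrow> 'b set set \<Rightarrow> ('a set \<Rightarrow> 'b set) set" where
  "Cl L M = {u \<in> L \<rightarrow> M. \<forall>S. S \<subseteq> L \<longrightarrow> u (cl_join L S) = cl_join M (u ` S)}"

definition atoms :: "'a set set \<Rightarrow> 'a set set" where
  "atoms L = {a \<in> L. a \<noteq> {} \<and> (\<forall>b\<in>L. b \<subseteq> a \<longrightarrow> b = {} \<or> b = a)}"

definition atom_preserving :: "'a set set \<Rightarrow> 'b set set \<Rightarrow> ('a set \<Rightarrow> 'b set) \<Rightarrow> bool" where
  "atom_preserving L M u \<longleftrightarrow> (\<forall>a\<in>atoms L. u a \<in> atoms M)"

text \<open>The point map induced by an atom-preserving \<open>u\<close>.\<close>

definition induced :: "('a set \<Rightarrow> 'b set) \<Rightarrow> 'a \<Rightarrow> 'b" where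
  "induced u p = the_elem (u {p})"

text \<open>Order isomorphism with the two-element lattice \<open>{False < True}\<close>.\<close>

definition is_two :: "'a set set \<Rightarrow> bool" where
  "is_two L \<longleftrightarrow> (\<exists>h :: 'a set \<Rightarrow> bool. bij_betw h L UNIV \<and>
                  (\<forall>A\<in>L. \<forall>B\<in>L. A \<subseteq> B \<longleftrightarrow> h A \<le> h B))"

definition connected_space :: "'a set \<Rightarrow> 'a set set \<Rightarrow> bool" where
  "connected_space X L \<longleftrightarrow> simple_closure_space X L \<and> \<not> is_two L \<and>
     (\<forall>p\<in>X. \<forall>q\<in>X. p \<noteq> q \<longrightarrow>
        (\<exists>r\<in>X. r \<noteq> p \<and> r \<noteq> q \<and> r \<in> cl_join L {{p}, {q}} \<and>
               p \<in> cl_join L {{q}, {r}} \<and> q \<in> cl_join L {{p}, {r}}))"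

text \<open>For a family of sets \<open>X i\<close>, \<open>i \<in> I\<close>, with product \<open>PiE I X\<close>:
  the preimage of \<open>B\<close> under the coordinate map \<open>b\<close>, and the set \<open>p[B,b]\<close>.\<close>

definition cylinder :: "'i set \<Rightarrow> ('i \<Rightarrow> 'a set) \<Rightarrow> 'i \<Rightarrow> 'a set \<Rightarrow> ('i \<Rightarrow> 'a) set" where
  "cylinder I X b B = {p \<in> PiE I X. p b \<in> B}"

definition replace_coord :: "('i \<Rightarrow> 'a) \<Rightarrow> 'a set \<Rightarrow> 'i \<Rightarrow> ('i \<Rightarrow> 'a) set" where
  "replace_coord p B b = (\<lambda>x. p(b := x)) ` B"

definition S_class ::
  "'i set \<Rightarrow> ('i \<Rightarrow> 'a set) \<Rightarrow> ('i \<Rightarrow> 'a set set) \<Rightarrow> ('i \<Rightarrow> 'a) set set set" where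
  "S_class I X Lf = {L. simple_closure_space (PiE I X) L \<and>
     (\<forall>a\<in>PiE I Lf. (\<Union>i\<in>I. cylinder I X i (a i)) \<in> L) \<and>
     (\<forall>p\<in>PiE I X. \<forall>b\<in>I. \<forall>B. B \<subseteq> X b \<longrightarrow> replace_coord p B b \<in> L \<longrightarrow> B \<in> Lf b)}"

definition large ::
  "'i set \<Rightarrow> ('i \<Rightarrow> 'a set) \<Rightarrow> ('i \<Rightarrow> 'a) set set \<Rightarrow>
   (('i \<Rightarrow> 'a) set \<Rightarrow> ('i \<Rightarrow> 'a) set) \<Rightarrow> bool" where
  "large I X L u \<longleftrightarrow> (\<forall>b\<in>I. \<forall>p\<in>PiE I X.
     u (replace_coord p (X b) b) \<notin> atoms L \<and>
     \<not> u (PiE I X) \<subseteq> cylinder I X b {p b})"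

lemma cl_join_least:
  assumes "simple_closure_space X L" "S \<subseteq> L"
  shows "cl_join L S \<in> L" "\<And>A. A \<in> S \<Longrightarrow> A \<subseteq> cl_join L S"
    "\<And>B. B \<in> L \<Longrightarrow> (\<And>A. A \<in> S \<Longrightarrow> A \<subseteq> B) \<Longrightarrow> cl_join L S \<subseteq> B"
proof -
  have "X \<in> {t. t \<in> L \<and> \<Union>S \<subseteq> t}"
    using assms unfolding simple_closure_space_def by blast
  then have "{t. t \<in> L \<and> \<Union>S \<subseteq> t} \<noteq> {}" "{t. t \<in> L \<and> \<Union>S \<subseteq> t} \<subseteq> L" by blast+
  then show "cl_join L S \<in> L"
    using assms(1) unfolding simple_closure_space_def cl_join_def hull_def by blast
  show "\<And>A. A \<in> S \<Longrightarrow> A \<subseteq> cl_join L S"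
    unfolding cl_join_def hull_def by blast
  show "\<And>B. B \<in> L \<Longrightarrow> (\<And>A. A \<in> S \<Longrightarrow> A \<subseteq> B) \<Longrightarrow> cl_join L S \<subseteq> B"
    unfolding cl_join_def hull_def by blast
qed

lemma atoms_eq_singletons:
  assumes "simple_closure_space X L"
  shows "atoms L = (\<lambda>p. {p}) ` X"
proof
  show "(\<lambda>p. {p}) ` X \<subseteq> atoms L"
    using assms unfolding simple_closure_space_def atoms_def by auto
  show "atoms L \<subseteq> (\<lambda>p. {p}) ` X"
  proof
    fix a assume a: "a \<in> atoms L"
    then obtain p where p: "p \<in> a" unfolding atoms_def by blast
    with a assms have "p \<in> X" "{p} \<in> L"
      unfolding simple_closure_space_def atoms_def by blast+
    with a p have "{p} = a" unfolding atoms_def by blast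
    with \<open>p \<in> X\<close> show "a \<in> (\<lambda>p. {p}) ` X" by blast
  qed
qed

text \<open>\<open>p[X b, b]\<close> belongs to every \<open>L\<close> in \<open>S_class I X Lf\<close>, so \<open>large\<close> applies \<open>u\<close>
  only to members of \<open>L\<close>.\<close>

lemma full_replace_in:
  assumes L: "L \<in> S_class I X Lf" and cs: "\<And>i. i \<in> I \<Longrightarrow> simple_closure_space (X i) (Lf i)"
    and p: "p \<in> PiE I X" and b: "b \<in> I"
  shows "replace_coord p (X b) b \<in> L"
proof -
  have scs: "simple_closure_space (PiE I X) L" using L unfolding S_class_def by blast
  have cyl: "cylinder I X i {p i} \<in> L" if i: "i \<in> I" for i
  proof -
    let ?a = "\<lambda>j\<in>I. if j = i then {p i} else {}"
    have "?a \<in> PiE I Lf"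
      using cs p by (auto simp: simple_closure_space_def PiE_iff)
    then have "(\<Union>j\<in>I. cylinder I X j (?a j)) \<in> L"
      using L unfolding S_class_def by blast
    moreover have "(\<Union>j\<in>I. cylinder I X j (?a j)) = cylinder I X i {p i}"
      using i by (auto simp: cylinder_def split: if_splits)
    ultimately show ?thesis by simp
  qed
  let ?F = "insert (PiE I X) ((\<lambda>i. cylinder I X i {p i}) ` (I - {b}))"
  have "\<Inter>?F \<in> L"
    using scs cyl unfolding simple_closure_space_def by (metis (no_types, lifting)
      DiffD1 image_subset_iff insert_not_empty insert_subset)
  moreover have "\<Inter>?F = replace_coord p (X b) b"
  proof (intro equalityI subsetI)
    fix q assume q: "q \<in> \<Inter>?F"
    then have qE: "q \<in> PiE I X" by blast
    have "q = p(b := q b)"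
    proof
      fix j show "q j = (p(b := q b)) j"
        using q qE p by (cases "j \<in> I") (auto simp: cylinder_def PiE_iff extensional_def)
    qed
    then show "q \<in> replace_coord p (X b) b"
      using qE b unfolding replace_coord_def by (metis PiE_mem image_eqI)
  next
    fix q assume "q \<in> replace_coord p (X b) b"
    then show "q \<in> \<Inter>?F"
      using p b by (auto simp: replace_coord_def cylinder_def PiE_iff extensional_def)
  qed
  ultimately show ?thesis by simp
qed

end

theory Submission
  imports Defs
begin

text \<open>The argument is about the point map \<open>U\<close> induced by \<open>u\<close>. Since \<open>u\<close> preserves joins,
  \<open>U\<close> pulls closed sets (members of \<open>L\<close>) back to closed sets, and by (P2) and (P3) the trace of a
  closed set of \<open>L\<close> on a line \<open>p[X i, i]\<close> is a closed set of the factor \<open>Lf i\<close>. Everything rests on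
  two properties of closed sets. In a connected space a closed set is never the union of two
  incomparable closed sets (\<open>connected_union_closed\<close>). In the product, two points which differ in at
  least two coordinates form a closed set (\<open>pair_closed\<close>).

  Together these force two points on a line to have images that differ in at most one coordinate:
  otherwise the two fibres over the closed pair of images would be incomparable with a closed union.
  Hence a line is mapped into a line, and not to a point because \<open>u\<close> is large; so the image has a
  well-defined direction. Neighbouring parallel lines have images of the same direction
  (\<open>moves_step\<close>): with different directions, the two images could only form a cross, and
  being sent to the centre of the cross on the one line or on the other would cover the line by two
  proper closed sets. As \<open>\<Omega>\<close> is finite, any two points are joined by changing one coordinate at a
  time, so the direction depends only on \<open>i\<close>; it is the required \<open>f i\<close>. A coordinate which is not of
  the form \<open>f i\<close> would be constant on the image of \<open>U\<close>, against largeness; so \<open>f\<close> is surjective,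
  hence bijective. Then only a change of the \<open>i\<close>-th coordinate affects \<open>U(p)\<close> at \<open>f i\<close>, and the
  restriction of \<open>U\<close> to a line in direction \<open>i\<close> is the point map of \<open>v i\<close>.\<close>

section \<open>Arrows and their point maps\<close>

lemma
  assumes "simple_closure_space X L"
  shows point_closed: "p \<in> X \<Longrightarrow> {p} \<in> L"
    and closed_subset: "A \<in> L \<Longrightarrow> A \<subseteq> X"
    and top_closed: "X \<in> L"
    and space_nonempty: "X \<noteq> {}"
    and Inter_closed: "\<A> \<subseteq> L \<Longrightarrow> \<A> \<noteq> {} \<Longrightarrow> \<Inter>\<A> \<in> L"
  using assms unfolding simple_closure_space_def by (simp_all add: subset_iff)

lemma Cl_mono:
  assumes L: "simple_closure_space X L" and M: "simple_closure_space Y M"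
    and u: "u \<in> Cl L M" and A: "A \<in> L" and B: "B \<in> L" and AB: "A \<subseteq> B"
  shows "u A \<subseteq> u B"
proof -
  have "cl_join L {A, B} = B"
    using cl_join_least[OF L, of "{A, B}"] A B AB by (intro equalityI) auto
  moreover have "u (cl_join L {A, B}) = cl_join M {u A, u B}"
    using u A B unfolding Cl_def by (simp add: image_insert)
  moreover have "u A \<in> M" "u B \<in> M" using u A B unfolding Cl_def by auto
  then have "u A \<subseteq> cl_join M {u A, u B}"
    using cl_join_least(2)[OF M, of "{u A, u B}" "u A"] by simp
  ultimately show ?thesis by simp
qed

text \<open>A closed set is the join of its points, so an arrow is determined by its values on points.\<close>

lemma Cl_least:
  assumes L: "simple_closure_space X L" and M: "simple_closure_space Y M"
    and u: "u \<in> Cl L M" and A: "A \<in> L" and B: "B \<in> M"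
    and AB: "\<And>p. p \<in> A \<Longrightarrow> u {p} \<subseteq> B"
  shows "u A \<subseteq> B"
proof -
  let ?S = "(\<lambda>p. {p}) ` A"
  have S: "?S \<subseteq> L" using point_closed[OF L] closed_subset[OF L A] by auto
  have "cl_join L ?S = A"
    using cl_join_least[OF L S] A by (intro equalityI) auto
  moreover have "u (cl_join L ?S) = cl_join M (u ` ?S)"
    using u S unfolding Cl_def by blast
  moreover have "u ` ?S \<subseteq> M" using u S unfolding Cl_def by blast
  then have "cl_join M (u ` ?S) \<subseteq> B"
    by (rule cl_join_least(3)[OF M]) (use B AB in auto)
  ultimately show ?thesis by simp
qed

lemma induced_point:
  assumes "simple_closure_space X L" and "simple_closure_space Y M"
    and "atom_preserving L M u" and "p \<in> X"
  shows "u {p} = {induced u p}" and "induced u p \<in> Y"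
proof -
  have "u {p} \<in> (\<lambda>q. {q}) ` Y"
    using assms(3,4) unfolding atom_preserving_def
      atoms_eq_singletons[OF assms(1)] atoms_eq_singletons[OF assms(2)] by simp
  then obtain q where "q \<in> Y" "u {p} = {q}" by auto
  then show "u {p} = {induced u p}" "induced u p \<in> Y"
    unfolding induced_def by simp_all
qed

lemma preimage_closed:
  assumes L: "simple_closure_space X L" and M: "simple_closure_space Y M"
    and u: "u \<in> Cl L M" and at: "atom_preserving L M u" and B: "B \<in> M"
  shows "{p \<in> X. induced u p \<in> B} \<in> L"
proof -
  let ?E = "{p \<in> X. induced u p \<in> B}"
  let ?S = "(\<lambda>p. {p}) ` ?E"
  have S: "?S \<subseteq> L" using point_closed[OF L] by auto
  note join = cl_join_least[OF L S]
  have "u ` ?S \<subseteq> M" using u S unfolding Cl_def by blast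
  then have "cl_join M (u ` ?S) \<subseteq> B"
    by (rule cl_join_least(3)[OF M]) (auto simp: B induced_point(1)[OF L M at])
  then have *: "u (cl_join L ?S) \<subseteq> B" using u S unfolding Cl_def by auto
  have "cl_join L ?S \<subseteq> ?E"
  proof
    fix p assume p: "p \<in> cl_join L ?S"
    have pX: "p \<in> X" using p closed_subset[OF L join(1)] by blast
    then have "{p} \<in> L" by (rule point_closed[OF L])
    then have "u {p} \<subseteq> B" using Cl_mono[OF L M u _ join(1), of "{p}"] p * by simp
    then show "p \<in> ?E" using induced_point[OF L M at pX] pX by simp
  qed
  moreover have "?E \<subseteq> cl_join L ?S" using join(2) by auto
  ultimately have "cl_join L ?S = ?E" by (rule subset_antisym)
  then show ?thesis using join(1) by simp
qed

text \<open>Conversely, every point map with closed preimages comes from an arrow, namely the one that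
  sends a closed set to the closure of its image.\<close>

definition join_extension :: "'b set set \<Rightarrow> ('a \<Rightarrow> 'b) \<Rightarrow> 'a set \<Rightarrow> 'b set" where
  "join_extension M g A = cl_join M ((\<lambda>x. {g x}) ` A)"

lemma
  assumes L: "simple_closure_space X L" and M: "simple_closure_space Y M"
    and g: "\<And>x. x \<in> X \<Longrightarrow> g x \<in> Y"
    and pre: "\<And>B. B \<in> M \<Longrightarrow> {x \<in> X. g x \<in> B} \<in> L"
  shows join_extension_Cl: "join_extension M g \<in> Cl L M"
    and join_extension_atoms: "atom_preserving L M (join_extension M g)"
    and induced_join_extension: "\<And>x. x \<in> X \<Longrightarrow> induced (join_extension M g) x = g x"
proof -
  let ?v = "join_extension M g"
  have in_M: "(\<lambda>x. {g x}) ` A \<subseteq> M" if "A \<in> L" for A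
    using point_closed[OF M] g closed_subset[OF L that] by auto
  have vM: "?v A \<in> M" if "A \<in> L" for A
    unfolding join_extension_def by (rule cl_join_least(1)[OF M in_M[OF that]])
  have v_le: "?v A \<subseteq> B \<longleftrightarrow> (\<forall>x\<in>A. g x \<in> B)" if "A \<in> L" "B \<in> M" for A B
    unfolding join_extension_def
    using cl_join_least(2)[OF M in_M[OF \<open>A \<in> L\<close>]]
      cl_join_least(3)[OF M in_M[OF \<open>A \<in> L\<close>] \<open>B \<in> M\<close>] by blast
  have "?v (cl_join L S) = cl_join M (?v ` S)" if S: "S \<subseteq> L" for S
  proof
    note joinL = cl_join_least[OF L S]
    have vS: "?v ` S \<subseteq> M" using vM S by blast
    note joinM = cl_join_least[OF M vS]
    let ?E = "{x \<in> X. g x \<in> cl_join M (?v ` S)}"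
    have "cl_join L S \<subseteq> ?E"
    proof (rule joinL(3)[OF pre[OF joinM(1)]])
      fix A assume A: "A \<in> S"
      then have "?v A \<subseteq> cl_join M (?v ` S)" using joinM(2) by blast
      moreover have "A \<in> L" using S A by blast
      moreover have "A \<subseteq> X" by (rule closed_subset[OF L \<open>A \<in> L\<close>])
      ultimately show "A \<subseteq> ?E" using v_le[OF _ joinM(1)] by blast
    qed
    then show "?v (cl_join L S) \<subseteq> cl_join M (?v ` S)"
      using v_le[OF joinL(1) joinM(1)] by blast
    show "cl_join M (?v ` S) \<subseteq> ?v (cl_join L S)"
    proof (rule joinM(3)[OF vM[OF joinL(1)]])
      fix B assume "B \<in> ?v ` S"
      then obtain A where A: "A \<in> S" "B = ?v A" by blast
      have "\<forall>x\<in>cl_join L S. g x \<in> ?v (cl_join L S)"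
        using v_le[OF joinL(1) vM[OF joinL(1)]] by blast
      then show "B \<subseteq> ?v (cl_join L S)"
        using v_le[OF _ vM[OF joinL(1)], of A] A S joinL(2) by blast
    qed
  qed
  then show "?v \<in> Cl L M" using vM unfolding Cl_def by blast
  have sing: "?v {x} = {g x}" if x: "x \<in> X" for x
  proof -
    have xL: "{x} \<in> L" and gM: "{g x} \<in> M"
      using point_closed[OF L] point_closed[OF M] x g by auto
    have "g x \<in> ?v {x}" using v_le[OF xL vM[OF xL]] by blast
    moreover have "?v {x} \<subseteq> {g x}" using v_le[OF xL gM] by blast
    ultimately show ?thesis by blast
  qed
  then show "atom_preserving L M ?v"
    using g unfolding atom_preserving_def atoms_eq_singletons[OF L] atoms_eq_singletons[OF M]
    by auto
  show "induced ?v x = g x" if "x \<in> X" for x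
    using sing[OF that] unfolding induced_def by simp
qed

section \<open>Closed sets in connected spaces and in products\<close>

text \<open>With \<open>p\<close> in \<open>V\<close> only and \<open>q\<close> in \<open>W\<close> only, the third atom \<open>r\<close> below \<open>p \<or> q\<close> would have to lie in
  \<open>V\<close> or in \<open>W\<close>; but each of these closed sets would then contain both \<open>p\<close> and \<open>q\<close>.\<close>

lemma connected_union_closed:
  assumes conn: "connected_space X L" and V: "V \<in> L" and W: "W \<in> L" and VW: "V \<union> W \<in> L"
  shows "V \<subseteq> W \<or> W \<subseteq> V"
proof (rule ccontr)
  have L: "simple_closure_space X L" using conn unfolding connected_space_def by blast
  assume "\<not> ?thesis"
  then obtain p q where p: "p \<in> V" "p \<notin> W" and q: "q \<in> W" "q \<notin> V" by blast
  have pq: "p \<in> X" "q \<in> X" "p \<noteq> q"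
    using p q closed_subset[OF L V] closed_subset[OF L W] by auto
  then obtain r where r: "r \<in> X" "r \<in> cl_join L {{p}, {q}}"
      "p \<in> cl_join L {{q}, {r}}" "q \<in> cl_join L {{p}, {r}}"
    using conn unfolding connected_space_def by blast
  have pair: "cl_join L {{a}, {b}} \<subseteq> C" if "a \<in> X" "b \<in> X" "C \<in> L" "a \<in> C" "b \<in> C" for a b C
  proof (rule cl_join_least(3)[OF L])
    show "{{a}, {b}} \<subseteq> L" using that point_closed[OF L] by simp
  qed (use that in auto)
  have "r \<in> V \<union> W" using pair[OF pq(1,2) VW] r p q by blast
  then show False
    using pair[OF pq(1) r(1) V] pair[OF pq(2) r(1) W] r p q by blast
qed

lemma Int_closed:
  assumes "simple_closure_space X L" "A \<in> L" "B \<in> L"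
  shows "A \<inter> B \<in> L"
  using Inter_closed[OF assms(1), of "{A, B}"] assms(2,3) by simp

lemma PiE_update:
  assumes "p \<in> PiE I X" "i \<in> I" "x \<in> X i"
  shows "p(i := x) \<in> PiE I X"
  using PiE_fun_upd[OF \<open>x \<in> X i\<close> \<open>p \<in> PiE I X\<close>] \<open>i \<in> I\<close> by (simp add: insert_absorb)

text \<open>A property of points of a finite product which survives changing one coordinate at a time
  spreads from one point to all of them.\<close>

lemma PiE_coordinate_induct:
  assumes fin: "finite I" and p: "p \<in> PiE I X" and q: "q \<in> PiE I X" and P: "P p"
    and step: "\<And>r i x. r \<in> PiE I X \<Longrightarrow> i \<in> I \<Longrightarrow> x \<in> X i \<Longrightarrow> P r \<Longrightarrow> P (r(i := x))"
  shows "P q"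
proof -
  have "override_on p q F \<in> PiE I X \<and> P (override_on p q F)" if "F \<subseteq> I" for F
    using finite_subset[OF that fin] that
  proof (induction F rule: finite_induct)
    case empty
    then show ?case using p P by simp
  next
    case (insert i F)
    then have r: "override_on p q F \<in> PiE I X" "P (override_on p q F)" and i: "i \<in> I"
      by auto
    have eq: "override_on p q (insert i F) = (override_on p q F)(i := q i)"
      by (simp add: override_on_def fun_eq_iff)
    show ?case unfolding eq
      by (rule conjI[OF PiE_update[OF r(1) i PiE_mem[OF q i]] step[OF r(1) i PiE_mem[OF q i] r(2)]])
  qed
  from this[of I] have "P (override_on p q I)" by simp
  moreover have "override_on p q I = q"
    using p q by (auto simp: override_on_def fun_eq_iff PiE_iff extensional_def)
  ultimately show ?thesis by simp
qed

locale product_closure =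
  fixes I :: "'i set" and X :: "'i \<Rightarrow> 'a set" and Lf :: "'i \<Rightarrow> 'a set set"
    and L :: "('i \<Rightarrow> 'a) set set"
  assumes factor: "\<And>i. i \<in> I \<Longrightarrow> simple_closure_space (X i) (Lf i)"
    and L_S: "L \<in> S_class I X Lf"
begin

lemma space: "simple_closure_space (PiE I X) L"
  using L_S unfolding S_class_def by blast

lemma cylinder_Un_closed:
  assumes i: "i \<in> I" and j: "j \<in> I" and "i \<noteq> j" and A: "A \<in> Lf i" and B: "B \<in> Lf j"
  shows "cylinder I X i A \<union> cylinder I X j B \<in> L"
proof -
  let ?a = "\<lambda>k\<in>I. if k = i then A else if k = j then B else {}"
  have "?a \<in> PiE I Lf"
    using A B factor by (auto simp: simple_closure_space_def PiE_iff)
  then have "(\<Union>k\<in>I. cylinder I X k (?a k)) \<in> L"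
    using L_S unfolding S_class_def by blast
  moreover have "(\<Union>k\<in>I. cylinder I X k (?a k)) = cylinder I X i A \<union> cylinder I X j B"
    using i j \<open>i \<noteq> j\<close> by (auto simp: cylinder_def split: if_splits)
  ultimately show ?thesis by simp
qed

lemma cylinder_closed:
  assumes i: "i \<in> I" and A: "A \<in> Lf i"
  shows "cylinder I X i A \<in> L"
proof -
  let ?a = "\<lambda>k\<in>I. if k = i then A else {}"
  have "?a \<in> PiE I Lf"
    using A factor by (auto simp: simple_closure_space_def PiE_iff)
  then have "(\<Union>k\<in>I. cylinder I X k (?a k)) \<in> L"
    using L_S unfolding S_class_def by blast
  moreover have "(\<Union>k\<in>I. cylinder I X k (?a k)) = cylinder I X i A"
    using i by (auto simp: cylinder_def split: if_splits)
  ultimately show ?thesis by simp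
qed

text \<open>Lines are closed, so (P3), which speaks of closed subsets of a line, applies to the part of any
  closed set that lies on it.\<close>

lemma line_trace_closed:
  assumes A: "A \<in> L" and p: "p \<in> PiE I X" and i: "i \<in> I"
  shows "{x \<in> X i. p(i := x) \<in> A} \<in> Lf i"
proof -
  let ?B = "{x \<in> X i. p(i := x) \<in> A}"
  have "A \<inter> replace_coord p (X i) i \<in> L"
    by (rule Int_closed[OF space A full_replace_in[OF L_S factor p i]])
  also have "A \<inter> replace_coord p (X i) i = replace_coord p ?B i"
    by (auto simp: replace_coord_def)
  finally have "replace_coord p ?B i \<in> L" .
  moreover have "\<forall>p\<in>PiE I X. \<forall>b\<in>I. \<forall>B. B \<subseteq> X b \<longrightarrow> replace_coord p B b \<in> L \<longrightarrow> B \<in> Lf b"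
    using L_S unfolding S_class_def by simp
  ultimately show ?thesis using p i by simp
qed

text \<open>The closed sets \<open>\<pi>\<^sub>i\<^sup>-\<^sup>1(q\<^sub>i) \<union> \<pi>\<^sub>j\<^sup>-\<^sup>1(r\<^sub>j)\<close> with \<open>i \<noteq> j\<close> all contain \<open>q\<close> and \<open>r\<close>. A point \<open>s\<close> of their
  intersection with \<open>s \<noteq> q\<close>, say \<open>s\<^sub>m \<noteq> q\<^sub>m\<close>, agrees with \<open>r\<close> at every coordinate but \<open>m\<close>;
  symmetrically \<open>s \<noteq> r\<close> makes it agree with \<open>q\<close> at every coordinate but one. If both
  happen, then the exceptional coordinates coincide, and \<open>q\<close> and \<open>r\<close> differ only there.\<close>

lemma pair_closed:
  assumes q: "q \<in> PiE I X" and r: "r \<in> PiE I X" and j: "j \<in> I" and k: "k \<in> I" and "j \<noteq> k"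
    and qj: "q j \<noteq> r j" and qk: "q k \<noteq> r k"
  shows "{q, r} \<in> L"
proof -
  let ?C = "\<lambda>(m, n). cylinder I X m {q m} \<union> cylinder I X n {r n}"
  let ?N = "{(m, n). m \<in> I \<and> n \<in> I \<and> m \<noteq> n}"
  have pt: "{s m} \<in> Lf m" if "s \<in> PiE I X" "m \<in> I" for s m
    by (rule point_closed[OF factor[OF \<open>m \<in> I\<close>] PiE_mem[OF that]])
  have "?C ` ?N \<subseteq> L"
    using cylinder_Un_closed pt q r by auto
  moreover have "?N \<noteq> {}" using j k \<open>j \<noteq> k\<close> by blast
  ultimately have "\<Inter>(?C ` ?N) \<in> L"
    by (intro Inter_closed[OF space]) (simp_all only: image_is_empty not_False_eq_True)
  moreover have "\<Inter>(?C ` ?N) = {q, r}"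
  proof
    show "{q, r} \<subseteq> \<Inter>(?C ` ?N)" using q r by (auto simp: cylinder_def)
    show "\<Inter>(?C ` ?N) \<subseteq> {q, r}"
    proof
      fix s assume s: "s \<in> \<Inter>(?C ` ?N)"
      then have "s \<in> ?C (j, k)" using j k \<open>j \<noteq> k\<close> by blast
      then have sE: "s \<in> PiE I X" by (auto simp: cylinder_def)
      have alt: "s m = q m \<or> s n = r n" if "m \<in> I" "n \<in> I" "m \<noteq> n" for m n
      proof -
        have "s \<in> ?C (m, n)" using s that by blast
        then show ?thesis by (auto simp: cylinder_def)
      qed
      show "s \<in> {q, r}"
      proof (rule ccontr)
        assume "s \<notin> {q, r}"
        then obtain m n where m: "m \<in> I" "s m \<noteq> q m" and n: "n \<in> I" "s n \<noteq> r n"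
          using PiE_ext[OF sE q] PiE_ext[OF sE r] by blast
        have "m = n" using alt m n by blast
        obtain l where l: "l \<in> I" "l \<noteq> m" "q l \<noteq> r l" using j k \<open>j \<noteq> k\<close> qj qk by metis
        have "s l = r l" using alt[OF m(1) l(1)] m(2) l(2) by blast
        moreover have "s l = q l" using alt[OF l(1) n(1)] n(2) l(2) \<open>m = n\<close> by blast
        ultimately show False using l(3) by simp
      qed
    qed
  qed
  ultimately show ?thesis by simp
qed

end

section \<open>The direction of the image of a line\<close>

locale line_map = product_closure +
  fixes U :: "('i \<Rightarrow> 'a) \<Rightarrow> ('i \<Rightarrow> 'a)"
  assumes connected: "\<And>i. i \<in> I \<Longrightarrow> connected_space (X i) (Lf i)"
    and U_in: "\<And>p. p \<in> PiE I X \<Longrightarrow> U p \<in> PiE I X"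
    and U_pre: "\<And>A. A \<in> L \<Longrightarrow> {p \<in> PiE I X. U p \<in> A} \<in> L"
    and U_line: "\<And>p i. p \<in> PiE I X \<Longrightarrow> i \<in> I \<Longrightarrow>
      \<exists>x\<in>X i. \<exists>y\<in>X i. U (p(i := x)) \<noteq> U (p(i := y))"
begin

lemma U_line_pre:
  assumes "A \<in> L" and p: "p \<in> PiE I X" and i: "i \<in> I"
  shows "{x \<in> X i. U (p(i := x)) \<in> A} \<in> Lf i"
proof -
  have "{x \<in> X i. U (p(i := x)) \<in> A} = {x \<in> X i. p(i := x) \<in> {q \<in> PiE I X. U q \<in> A}}"
    using PiE_update[OF p i] by blast
  then show ?thesis using line_trace_closed[OF U_pre[OF \<open>A \<in> L\<close>] p i] by simp
qed

lemma U_coord_pre: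
  assumes p: "p \<in> PiE I X" and i: "i \<in> I" and j: "j \<in> I" and B: "B \<in> Lf j"
  shows "{x \<in> X i. U (p(i := x)) j \<in> B} \<in> Lf i"
proof -
  have "{x \<in> X i. U (p(i := x)) j \<in> B} = {x \<in> X i. U (p(i := x)) \<in> cylinder I X j B}"
    using U_in[OF PiE_update[OF p i]] by (auto simp: cylinder_def)
  then show ?thesis using U_line_pre[OF cylinder_closed[OF j B] p i] by simp
qed

text \<open>If two points on a line had images \<open>a\<close> and \<open>b\<close> that differ twice, then \<open>{a, b}\<close> would be closed,
  and with it the union of the closed fibres over \<open>a\<close> and \<open>b\<close> on that line; but nonempty disjoint
  fibres are incomparable.\<close>

lemma U_differ_once:
  assumes p: "p \<in> PiE I X" and i: "i \<in> I" and x: "x \<in> X i" and y: "y \<in> X i"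
    and j: "j \<in> I" "U (p(i := x)) j \<noteq> U (p(i := y)) j"
    and k: "k \<in> I" "U (p(i := x)) k \<noteq> U (p(i := y)) k"
  shows "j = k"
proof (rule ccontr)
  assume "j \<noteq> k"
  let ?a = "U (p(i := x))" and ?b = "U (p(i := y))"
  let ?F = "\<lambda>A. {z \<in> X i. U (p(i := z)) \<in> A}"
  have ab: "?a \<in> PiE I X" "?b \<in> PiE I X"
    using U_in[OF PiE_update[OF p i]] x y by simp_all
  have pts: "{?a} \<in> L" "{?b} \<in> L" using point_closed[OF space] ab by auto
  have "{?a, ?b} \<in> L" by (rule pair_closed[OF ab j(1) k(1) \<open>j \<noteq> k\<close> j(2) k(2)])
  then have "?F {?a, ?b} \<in> Lf i" by (rule U_line_pre[OF _ p i])
  moreover have "?F {?a, ?b} = ?F {?a} \<union> ?F {?b}" by auto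
  ultimately have "?F {?a} \<union> ?F {?b} \<in> Lf i" by simp
  then have "?F {?a} \<subseteq> ?F {?b} \<or> ?F {?b} \<subseteq> ?F {?a}"
    by (rule connected_union_closed[OF connected[OF i]
        U_line_pre[OF pts(1) p i] U_line_pre[OF pts(2) p i]])
  then have "?a = ?b" using x y by auto
  then show False using j by simp
qed

text \<open>The line through \<open>p\<close> in direction \<open>i\<close> has an image in direction \<open>j\<close>.\<close>

definition moves :: "'i \<Rightarrow> ('i \<Rightarrow> 'a) \<Rightarrow> 'i \<Rightarrow> bool" where
  "moves i p j \<longleftrightarrow> (\<exists>x\<in>X i. \<exists>y\<in>X i. U (p(i := x)) j \<noteq> U (p(i := y)) j)"

lemma moves_exists:
  assumes p: "p \<in> PiE I X" and i: "i \<in> I"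
  obtains j where "j \<in> I" "moves i p j"
proof -
  obtain x y where xy: "x \<in> X i" "y \<in> X i" "U (p(i := x)) \<noteq> U (p(i := y))"
    using U_line[OF p i] by blast
  then obtain j where "j \<in> I" "U (p(i := x)) j \<noteq> U (p(i := y)) j"
    using PiE_ext U_in PiE_update[OF p i] by metis
  then show ?thesis using that xy unfolding moves_def by blast
qed

text \<open>Points that pairwise differ in a single coordinate all differ in the same one: if \<open>x\<close>, \<open>y\<close>
  differ at \<open>j\<close>, then they agree at \<open>k\<close>, so a point \<open>z\<close> with another entry at \<open>k\<close> must agree
  with both of them at \<open>j\<close>.\<close>

lemma moves_unique:
  assumes p: "p \<in> PiE I X" and i: "i \<in> I" and j: "j \<in> I" "moves i p j" and k: "k \<in> I" "moves i p k"
  shows "j = k"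
proof (rule ccontr)
  assume "j \<noteq> k"
  obtain x y where xy: "x \<in> X i" "y \<in> X i" "U (p(i := x)) j \<noteq> U (p(i := y)) j"
    using j unfolding moves_def by blast
  have agree: "U (p(i := a)) j = U (p(i := b)) j \<or> U (p(i := a)) k = U (p(i := b)) k"
    if "a \<in> X i" "b \<in> X i" for a b
    using U_differ_once[OF p i that j(1) _ k(1)] \<open>j \<noteq> k\<close> by blast
  have xyk: "U (p(i := x)) k = U (p(i := y)) k" using agree xy by blast
  obtain z where z: "z \<in> X i" "U (p(i := z)) k \<noteq> U (p(i := x)) k"
    using k unfolding moves_def by metis
  have "U (p(i := z)) j = U (p(i := x)) j" using agree[OF z(1) xy(1)] z(2) by blast
  moreover have "U (p(i := z)) j = U (p(i := y)) j"
    using agree[OF z(1) xy(2)] z(2) xyk by auto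
  ultimately show False using xy(3) by simp
qed

text \<open>If the image of the line through \<open>p\<close> has direction \<open>j\<close> and that of the parallel line through
  \<open>p(m := z)\<close> another direction \<open>k\<close>, then the former has a constant \<open>k\<close>-th and the latter a constant
  \<open>j\<close>-th coordinate. The images of corresponding points differ at most once, so that for every
  \<open>x\<close> the first image has the \<open>j\<close>-th coordinate of the second line, or the second image has the
  \<open>k\<close>-th coordinate of the first. These are two closed conditions on \<open>x\<close> which cover \<open>X i\<close>, and
  neither holds throughout, as both images move.\<close>

lemma moves_step:
  assumes p: "p \<in> PiE I X" and i: "i \<in> I" and j: "j \<in> I" "moves i p j"
    and m: "m \<in> I" and z: "z \<in> X m"
  shows "moves i (p(m := z)) j"
proof (cases "m = i")
  case True
  then show ?thesis using j unfolding moves_def by simp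
next
  case False
  let ?p = "p(m := z)"
  have p': "?p \<in> PiE I X" by (rule PiE_update[OF p m z])
  obtain k where k: "k \<in> I" "moves i ?p k" using moves_exists[OF p' i] .
  have "k = j"
  proof (rule ccontr)
    assume "k \<noteq> j"
    have "\<not> moves i p k" using moves_unique[OF p i j k(1)] \<open>k \<noteq> j\<close> by blast
    moreover have "\<not> moves i ?p j" using moves_unique[OF p' i k j(1)] \<open>k \<noteq> j\<close> by blast
    moreover have fix_p: "p(i := p i) = p" "?p(i := ?p i) = ?p" by (rule fun_upd_triv)+
    define a b where "a = U ?p j" and "b = U p k"
    ultimately have const: "\<And>x. x \<in> X i \<Longrightarrow> U (p(i := x)) k = b"
        "\<And>x. x \<in> X i \<Longrightarrow> U (?p(i := x)) j = a"
      using PiE_mem[OF p i] PiE_mem[OF p' i] unfolding moves_def a_def b_def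
      by (metis fix_p)+
    have "{a} \<in> Lf j" "{b} \<in> Lf k"
      unfolding a_def b_def
      by (rule point_closed[OF factor[OF j(1)] PiE_mem[OF U_in[OF p'] j(1)]],
          rule point_closed[OF factor[OF k(1)] PiE_mem[OF U_in[OF p] k(1)]])
    let ?V = "{x \<in> X i. U (p(i := x)) j \<in> {a}}" and ?W = "{x \<in> X i. U (?p(i := x)) k \<in> {b}}"
    have V: "?V \<in> Lf i" and W: "?W \<in> Lf i"
      by (rule U_coord_pre[OF p i j(1) \<open>{a} \<in> Lf j\<close>], rule U_coord_pre[OF p' i k(1) \<open>{b} \<in> Lf k\<close>])
    have "x \<in> ?V \<union> ?W" if x: "x \<in> X i" for x
    proof -
      have q: "p(i := x) \<in> PiE I X" by (rule PiE_update[OF p i x])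
      have eq: "(p(i := x))(m := p m) = p(i := x)" "(p(i := x))(m := z) = ?p(i := x)"
        using False by (auto simp: fun_eq_iff)
      have "U (p(i := x)) j = U (?p(i := x)) j \<or> U (p(i := x)) k = U (?p(i := x)) k"
        using U_differ_once[OF q m PiE_mem[OF p m] z j(1) _ k(1)] \<open>k \<noteq> j\<close> unfolding eq by blast
      then show ?thesis using const x by auto
    qed
    then have VW: "?V \<union> ?W = X i" by blast
    then have "?V \<union> ?W \<in> Lf i" using top_closed[OF factor[OF i]] by simp
    then have "?V \<subseteq> ?W \<or> ?W \<subseteq> ?V" by (rule connected_union_closed[OF connected[OF i] V W])
    then have "?V = X i \<or> ?W = X i" using VW by (simp only: subset_Un_eq Un_commute) auto
    then have "(\<forall>x\<in>X i. U (p(i := x)) j = a) \<or> (\<forall>x\<in>X i. U (?p(i := x)) k = b)" by blast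
    then show False using j(2) k(2) unfolding moves_def by auto
  qed
  then show ?thesis using k by simp
qed

lemma moves_global:
  assumes fin: "finite I" and i: "i \<in> I"
  obtains j where "j \<in> I" "\<And>p k. p \<in> PiE I X \<Longrightarrow> k \<in> I \<Longrightarrow> moves i p k \<longleftrightarrow> k = j"
proof -
  obtain p0 where p0: "p0 \<in> PiE I X" using space_nonempty[OF space] by blast
  obtain j where j: "j \<in> I" "moves i p0 j" using moves_exists[OF p0 i] .
  have "moves i p j" if "p \<in> PiE I X" for p
    by (rule PiE_coordinate_induct[where P = "\<lambda>p. moves i p j", OF fin p0 that j(2)])
      (rule moves_step[OF _ i j(1)])
  then have "moves i p k \<longleftrightarrow> k = j" if "p \<in> PiE I X" "k \<in> I" for p k
    using moves_unique[OF that(1) i that(2) _ j(1)] that by blast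
  then show ?thesis by (rule that[OF j(1)])
qed

text \<open>A coordinate outside the range of the direction map would never change, hence be constant on
  the image of \<open>U\<close>; the hypothesis \<open>spread\<close>, the condition of largeness on \<open>u(1)\<close>, excludes this.
  Injectivity of the direction map then keeps different coordinates from influencing the same one.\<close>

lemma direction_bijection:
  assumes fin: "finite I"
    and spread: "\<And>k c. k \<in> I \<Longrightarrow> c \<in> X k \<Longrightarrow> \<exists>p\<in>PiE I X. U p k \<noteq> c"
  obtains f where "bij_betw f I I"
    "\<And>p q i. p \<in> PiE I X \<Longrightarrow> q \<in> PiE I X \<Longrightarrow> i \<in> I \<Longrightarrow> p i = q i \<Longrightarrow> U p (f i) = U q (f i)"
proof -
  have "\<exists>j\<in>I. \<forall>p\<in>PiE I X. \<forall>k\<in>I. moves i p k \<longleftrightarrow> k = j" if "i \<in> I" for i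
    using moves_global[OF fin that] by metis
  then obtain f where f: "\<And>i. i \<in> I \<Longrightarrow> f i \<in> I"
      "\<And>i p k. i \<in> I \<Longrightarrow> p \<in> PiE I X \<Longrightarrow> k \<in> I \<Longrightarrow> moves i p k \<longleftrightarrow> k = f i"
    by metis
  have still: "U (p(m := z)) k = U p k"
    if "p \<in> PiE I X" "m \<in> I" "z \<in> X m" "k \<in> I" "k \<noteq> f m" for p m z k
  proof -
    have "\<not> moves m p k" using f(2) that by blast
    then have "U (p(m := z)) k = U (p(m := p m)) k"
      using that PiE_mem[of p I X m] unfolding moves_def by blast
    then show ?thesis by simp
  qed
  have "I \<subseteq> f ` I"
  proof
    fix k assume k: "k \<in> I"
    show "k \<in> f ` I"
    proof (rule ccontr)
      assume "k \<notin> f ` I"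
      then have nk: "k \<noteq> f m" if "m \<in> I" for m using that by blast
      obtain p0 where p0: "p0 \<in> PiE I X" using space_nonempty[OF space] by blast
      have "U p k = U p0 k" if "p \<in> PiE I X" for p
        by (rule PiE_coordinate_induct[where P = "\<lambda>p. U p k = U p0 k", OF fin p0 that])
          (simp_all add: still k nk)
      then show False using spread[OF k] PiE_mem[OF U_in[OF p0] k] by blast
    qed
  qed
  then have im: "f ` I = I" and inj: "inj_on f I"
    using f(1) finite_surj_inj[OF fin] by blast+
  have "U p (f i) = U q (f i)"
    if p: "p \<in> PiE I X" and q: "q \<in> PiE I X" and i: "i \<in> I" and pq: "p i = q i" for p q i
  proof -
    \<comment> \<open>Resetting the \<open>i\<close>-th entry to \<open>p i\<close> makes the invariant independent of that entry.\<close>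
    have "U (q(i := p i)) (f i) = U p (f i)"
    proof (rule PiE_coordinate_induct[where P = "\<lambda>r. U (r(i := p i)) (f i) = U p (f i)", OF fin p q])
      fix r m z assume r: "r \<in> PiE I X" and m: "m \<in> I" and z: "z \<in> X m"
        and IH: "U (r(i := p i)) (f i) = U p (f i)"
      show "U ((r(m := z))(i := p i)) (f i) = U p (f i)"
      proof (cases "m = i")
        case True
        then show ?thesis using IH by simp
      next
        case False
        have "f i \<noteq> f m" using inj i m False by (auto simp: inj_on_def)
        then have "U ((r(i := p i))(m := z)) (f i) = U (r(i := p i)) (f i)"
          using still[OF PiE_update[OF r i PiE_mem[OF p i]] m z f(1)[OF i]] by simp
        then show ?thesis using IH False by (simp add: fun_upd_twist)
      qed
    qed simp
    then show ?thesis using pq by simp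
  qed
  then show ?thesis using that[of f] im inj unfolding bij_betw_def by blast
qed

end

section \<open>Decomposition of large arrows\<close>

theorem theorem6p5:
  fixes \<Omega> :: "'i set" and X :: "'i \<Rightarrow> 'a set" and Lf :: "'i \<Rightarrow> 'a set set"
    and L :: "('i \<Rightarrow> 'a) set set" and u :: "('i \<Rightarrow> 'a) set \<Rightarrow> ('i \<Rightarrow> 'a) set"
  assumes "finite \<Omega>"
    and "\<And>i. i \<in> \<Omega> \<Longrightarrow> connected_space (X i) (Lf i)"
    and "L \<in> S_class \<Omega> X Lf"
    and "u \<in> Cl L L"
    and "large \<Omega> X L u"
    and "atom_preserving L L u"
  shows "\<exists>f v. bij_betw f \<Omega> \<Omega> \<and>
           (\<forall>i\<in>\<Omega>. v i \<in> Cl (Lf i) (Lf (f i)) \<and> atom_preserving (Lf i) (Lf (f i)) (v i) \<and>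
              (\<forall>p\<in>PiE \<Omega> X. induced u p (f i) = induced (v i) (p i)))"
proof -
  let ?U = "induced u"
  interpret product_closure \<Omega> X Lf L
    by unfold_locales (use assms(2,3) in \<open>simp_all add: connected_space_def\<close>)
  note point = induced_point[OF space space assms(6)]
  note least = Cl_least[OF space space assms(4)]
  interpret line_map \<Omega> X Lf L ?U
  proof
    show "connected_space (X i) (Lf i)" if "i \<in> \<Omega>" for i using assms(2) that .
    show "?U p \<in> PiE \<Omega> X" if "p \<in> PiE \<Omega> X" for p using point(2) that .
    show "{p \<in> PiE \<Omega> X. ?U p \<in> A} \<in> L" if "A \<in> L" for A
      by (rule preimage_closed[OF space space assms(4,6) that])
    show "\<exists>x\<in>X i. \<exists>y\<in>X i. ?U (p(i := x)) \<noteq> ?U (p(i := y))" if p: "p \<in> PiE \<Omega> X" and i: "i \<in> \<Omega>" for p i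
    proof (rule ccontr)
      assume "\<not> ?thesis"
      then have "?U (p(i := x)) = ?U (p(i := p i))" if "x \<in> X i" for x
        using that PiE_mem[OF p i] by blast
      then have const: "?U (p(i := x)) = ?U p" if "x \<in> X i" for x using that by simp
      let ?l = "replace_coord p (X i) i"
      have l: "?l \<in> L" by (rule full_replace_in[OF assms(3) factor p i])
      have Up: "{?U p} \<in> L" and pL: "{p} \<in> L"
        using point_closed[OF space] point(2)[OF p] p by auto
      have "u ?l \<subseteq> {?U p}"
        by (rule least[OF l Up])
          (auto simp: replace_coord_def const point(1)[OF PiE_update[OF p i]])
      moreover have "p(i := p i) \<in> ?l"
        unfolding replace_coord_def by (rule imageI[OF PiE_mem[OF p i]])
      then have "{p} \<subseteq> ?l" by simp
      then have "u {p} \<subseteq> u ?l" by (rule Cl_mono[OF space space assms(4) pL l])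
      ultimately have "u ?l = {?U p}" using point(1)[OF p] by blast
      then have "u ?l \<in> atoms L" using atoms_eq_singletons[OF space] point(2)[OF p] by simp
      then show False using assms(5) p i unfolding large_def by simp
    qed
  qed
  obtain p0 where p0: "p0 \<in> PiE \<Omega> X" using space_nonempty[OF space] by blast
  have "\<exists>p\<in>PiE \<Omega> X. ?U p k \<noteq> c" if k: "k \<in> \<Omega>" and c: "c \<in> X k" for k c
  proof (rule ccontr)
    assume "\<not> ?thesis"
    then have const: "?U p k = c" if "p \<in> PiE \<Omega> X" for p using that by blast
    have "{c} \<in> Lf k" by (rule point_closed[OF factor[OF k] c])
    then have cyl: "cylinder \<Omega> X k {c} \<in> L" by (rule cylinder_closed[OF k])
    have "PiE \<Omega> X \<in> L" by (rule top_closed[OF space])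
    then have "u (PiE \<Omega> X) \<subseteq> cylinder \<Omega> X k {c}"
      by (rule least[OF _ cyl]) (simp add: cylinder_def point const)
    then have "u (PiE \<Omega> X) \<subseteq> cylinder \<Omega> X k {(p0(k := c)) k}" by simp
    then show False
      using assms(5) PiE_update[OF p0 k c] k unfolding large_def by blast
  qed
  from direction_bijection[OF assms(1) this]
  obtain f where bij: "bij_betw f \<Omega> \<Omega>" and dep: "\<And>p q i. p \<in> PiE \<Omega> X \<Longrightarrow> q \<in> PiE \<Omega> X \<Longrightarrow>
      i \<in> \<Omega> \<Longrightarrow> p i = q i \<Longrightarrow> ?U p (f i) = ?U q (f i)"
    by blast
  define g where "g i x = ?U (p0(i := x)) (f i)" for i x
  define v where "v i = join_extension (Lf (f i)) (g i)" for i
  have "v i \<in> Cl (Lf i) (Lf (f i)) \<and> atom_preserving (Lf i) (Lf (f i)) (v i) \<and>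
      (\<forall>p\<in>PiE \<Omega> X. ?U p (f i) = induced (v i) (p i))" if i: "i \<in> \<Omega>" for i
  proof -
    have fi: "f i \<in> \<Omega>" using bij i by (auto simp: bij_betw_def)
    have g_in: "g i x \<in> X (f i)" if "x \<in> X i" for x
      unfolding g_def by (rule PiE_mem[OF point(2)[OF PiE_update[OF p0 i that]] fi])
    have g_pre: "{x \<in> X i. g i x \<in> B} \<in> Lf i" if "B \<in> Lf (f i)" for B
      unfolding g_def by (rule U_coord_pre[OF p0 i fi that])
    note ext = factor[OF i] factor[OF fi] g_in g_pre
    have "?U p (f i) = induced (v i) (p i)" if p: "p \<in> PiE \<Omega> X" for p
    proof -
      have "?U p (f i) = g i (p i)"
        unfolding g_def by (rule dep[OF p PiE_update[OF p0 i PiE_mem[OF p i]] i]) simp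
      then show ?thesis
        unfolding v_def using induced_join_extension[OF ext PiE_mem[OF p i]] by simp
    qed
    then show ?thesis
      using join_extension_Cl[OF ext] join_extension_atoms[OF ext] unfolding v_def by blast
  qed
  then show ?thesis using bij by blast
qed

end
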